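(* For $n\in\mathbb{N}=\{1,2,3,\dots\}$ let $$w_n := 2-\sqrt{\frac{n+1}{n}}-\sqrt{\frac{n-1}{n}}.$$ For every finitely supported complex sequence $u=\{u_n\}_{n=0}^{\infty}$ with $u_0=0$, one has the identity $$\sum_{n=1}^{\infty} w_n |u_n|^2 + \sum_{n=2}^{\infty}\left|\sqrt[4]{\frac{n-1}{n}}\,u_n-\sqrt[4]{\frac{n}{n-1}}\,u_{n-1}\right|^2=\sum_{n=1}^{\infty}|u_n-u_{n-1}|^2 .$$ In particular, the inequality $$\sum_{n=1}^{\infty} w_n|u_n|^2\le \sum_{n=1}^{\infty}|u_n-u_{n-1}|^2$$ holds for all complex sequences $u=\{u_n\}_{n=0}^{\infty}$ with $u_0=0$ and, in addition, it is optimal in the following sense: if $\tilde w=\{\tilde w_n\}_{n=1}^\infty$ is a real sequence with $\tilde w_n\ge w_n$ for all $n\in\mathbb{N}$ such that $$\sum_{n=1}^{\infty} \tilde w_n|u_n|^2\le \sum_{n=1}^{\infty}|u_n-u_{n-1}|^2$$ holds for all complex sequences $u=\{u_n\}_{n=0}^{\infty}$ with $u_0=0$, then $\tilde w_n=w_n$ for all $n\in\mathbb{N}$.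
   Context: A sequence $\{u_n\}_{n=0}^\infty$ is finitely supported if $u_n\neq 0$ for only finitely many $n$. The weights satisfy $w_n>\frac{1}{4n^2}>0$, so all sums are sums of nonnegative terms; for sequences that are not finitely supported the sums are understood as elements of $[0,\infty]$ (the right-hand side may be $+\infty$, in which case the inequality is trivially true). *)

theory Defs
  imports "HOL-Analysis.Analysis"
begin

(* Only meaningful for n \<ge> 1; the value at n = 0 is an artefact of x / 0 = 0 and is never used. *)
definition hardy_weight :: "nat \<Rightarrow> real" where
  "hardy_weight n = 2 - sqrt ((real n + 1) / real n) - sqrt ((real n - 1) / real n)"

(* Ensures that ennreal, which truncates negative reals to 0, does not alter the weighted terms. *)
lemma hardy_weight_pos:
  assumes "n \<ge> 1"
  shows "hardy_weight n > 0"
proof -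
  define a b where "a = sqrt ((real n + 1) / real n)" and "b = sqrt ((real n - 1) / real n)"
  have n: "real n \<ge> 1" using assms by simp
  have a2: "a\<^sup>2 = (real n + 1) / real n" and b2: "b\<^sup>2 = (real n - 1) / real n"
    unfolding a_def b_def using n by simp_all
  have sum: "a\<^sup>2 + b\<^sup>2 = 2" and neq: "a\<^sup>2 \<noteq> b\<^sup>2"
    unfolding a2 b2 using n by (simp_all add: field_simps)
  from neq have "(a - b)\<^sup>2 > 0" by auto
  then have "(a + b)\<^sup>2 < 2\<^sup>2"
    using sum by (simp add: power2_eq_square algebra_simps)
  then have "a + b < 2" by (rule power2_less_imp_less) simp
  then show ?thesis unfolding hardy_weight_def a_def b_def by simp
qed

(* The extended nonnegative value of the weighted sum, for a nonnegative weight. *)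
definition weighted_sum :: "(nat \<Rightarrow> real) \<Rightarrow> (nat \<Rightarrow> complex) \<Rightarrow> ennreal" where
  "weighted_sum v u = (\<Sum>\<^sub>\<infinity>n\<in>{1..}. ennreal (v n * (cmod (u n))\<^sup>2))"

definition difference_sum :: "(nat \<Rightarrow> complex) \<Rightarrow> ennreal" where
  "difference_sum u = (\<Sum>\<^sub>\<infinity>n\<in>{1..}. ennreal ((cmod (u n - u (n - 1)))\<^sup>2))"

end

theory Submission
  imports Defs
begin

text \<open>
  Write $r = \sqrt[4]{(n-1)/n}$. Expanding the square gives
  $|a-b|^2 = |ra-b/r|^2 + (1-r^2)|a|^2 + (1-r^{-2})|b|^2$, and $w_n$ is the sum of the coefficients
  that $|u_n|^2$ receives from two consecutive terms. Truncating at $N$ leaves the extra boundary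
  term $(\sqrt{(N+1)/N}-1)|u_N|^2$, which vanishes for large $N$ when $u$ is finitely supported
  and is nonnegative in general; hence both the identity and the inequality.
  For optimality, the remainder vanishes on $u_n=\sqrt n$. With the logarithmic cutoff
  $u_n = \sqrt n\,(1-H_n/H_N)$ it is at most $1/H_N$, while $u_m \to \sqrt m$ for each fixed $m$,
  so no weight can be enlarged.
\<close>

section \<open>Remainder terms and the identity\<close>

definition hardy_remainder :: "(nat \<Rightarrow> complex) \<Rightarrow> nat \<Rightarrow> real" where
  "hardy_remainder u n = (cmod (of_real (root 4 ((real n - 1) / real n)) * u n
     - of_real (root 4 (real n / (real n - 1))) * u (n - 1)))\<^sup>2"

text \<open>Since \<open>r * s = 1\<close>, the cross term in \<open>a\<close> and \<open>b\<close>
  is the same as in the unscaled square, so the scaling only changes the coefficients of the two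
  squared moduli.\<close>

lemma cmod_diff_scaled_square:
  assumes "r * s = 1"
  shows "(cmod (of_real r * a - of_real s * b))\<^sup>2 =
    (cmod (a - b))\<^sup>2 - (1 - r\<^sup>2) * (cmod a)\<^sup>2 - (1 - s\<^sup>2) * (cmod b)\<^sup>2"
proof -
  have "(r * Re a - s * Re b)\<^sup>2 + (r * Im a - s * Im b)\<^sup>2 =
      r\<^sup>2 * ((Re a)\<^sup>2 + (Im a)\<^sup>2) + s\<^sup>2 * ((Re b)\<^sup>2 + (Im b)\<^sup>2)
      - 2 * (r * s) * (Re a * Re b + Im a * Im b)"
    by (simp add: power2_eq_square algebra_simps)
  then show ?thesis
    unfolding cmod_power2 using assms by (simp add: power2_eq_square algebra_simps)
qed

lemma root_4_power2: "x \<ge> 0 \<Longrightarrow> (root 4 x)\<^sup>2 = sqrt x"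
  using real_root_mult_exp[of 2 2 x] by (simp add: sqrt_def)

lemma hardy_remainder_expand:
  assumes "n \<ge> 2"
  shows "hardy_remainder u n = (cmod (u n - u (n - 1)))\<^sup>2
    - (1 - sqrt ((real n - 1) / real n)) * (cmod (u n))\<^sup>2
    - (1 - sqrt (real n / (real n - 1))) * (cmod (u (n - 1)))\<^sup>2"
proof -
  have n: "real n \<ge> 2" using assms by simp
  have "root 4 ((real n - 1) / real n) * root 4 (real n / (real n - 1)) = 1"
    using n by (simp flip: real_root_mult)
  then show ?thesis
    unfolding hardy_remainder_def using n by (simp add: cmod_diff_scaled_square root_4_power2)
qed

text \<open>Telescoping: the coefficient of the squared modulus of \<open>u N\<close> in the
  remainder at \<open>Suc N\<close> cancels the old boundary term, and
  \<open>hardy_weight (Suc N)\<close> supplies the rest together with the new boundary term.\<close>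

lemma hardy_partial_identity:
  assumes "u 0 = 0" "N \<ge> 1"
  shows "(\<Sum>n=1..N. hardy_weight n * (cmod (u n))\<^sup>2) + (\<Sum>n=2..N. hardy_remainder u n)
    + (sqrt ((real N + 1) / real N) - 1) * (cmod (u N))\<^sup>2
    = (\<Sum>n=1..N. (cmod (u n - u (n - 1)))\<^sup>2)"
  using assms(2)
proof (induction N rule: dec_induct)
  case base
  \<comment> \<open>For N = 1 the remainder sum is empty and the second root in
    \<open>hardy_weight 1\<close> is 0, so weight and boundary coefficient add up to 1, matching the
    first difference because \<open>u 0 = 0\<close>.\<close>
  then show ?case using assms(1) by (simp add: hardy_weight_def algebra_simps)
next
  case (step N)
  have "hardy_remainder u (Suc N) = (cmod (u (Suc N) - u N))\<^sup>2
    - (1 - sqrt (real N / real (Suc N))) * (cmod (u (Suc N)))\<^sup>2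
    - (1 - sqrt ((real N + 1) / real N)) * (cmod (u N))\<^sup>2"
    using hardy_remainder_expand[of "Suc N" u] step.hyps by (simp add: add_ac)
  moreover have "hardy_weight (Suc N) * (cmod (u (Suc N)))\<^sup>2 = 2 * (cmod (u (Suc N)))\<^sup>2
      - sqrt ((real (Suc N) + 1) / real (Suc N)) * (cmod (u (Suc N)))\<^sup>2
      - sqrt (real N / real (Suc N)) * (cmod (u (Suc N)))\<^sup>2"
    by (simp add: hardy_weight_def left_diff_distrib)
  ultimately show ?case
    using step.IH step.hyps by (simp add: algebra_simps)
qed

text \<open>Stated for a general topological monoid because it serves real sums in the identity and
  \<open>ennreal\<close> sums in the optimality argument.\<close>

lemma infsum_eq_sum_atLeastAtMost:
  fixes f :: "nat \<Rightarrow> 'a :: {t2_space, topological_comm_monoid_add}"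
  assumes "\<And>n. n > N \<Longrightarrow> f n = 0"
  shows "(\<Sum>\<^sub>\<infinity>n\<in>{k..}. f n) = (\<Sum>n=k..N. f n)"
proof -
  have "(\<Sum>\<^sub>\<infinity>n\<in>{k..}. f n) = (\<Sum>\<^sub>\<infinity>n\<in>{k..N}. f n)"
    by (rule infsum_cong_neutral) (auto intro: assms)
  then show ?thesis by simp
qed

lemma hardy_identity:
  assumes "u 0 = 0" "\<And>n. n \<ge> N \<Longrightarrow> u n = 0"
  shows "(\<Sum>\<^sub>\<infinity>n\<in>{1..}. hardy_weight n * (cmod (u n))\<^sup>2) + (\<Sum>\<^sub>\<infinity>n\<in>{2..}. hardy_remainder u n)
    = (\<Sum>\<^sub>\<infinity>n\<in>{1..}. (cmod (u n - u (n - 1)))\<^sup>2)"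
proof -
  \<comment> \<open>\<open>Suc N\<close> keeps the cut at least 1, as
    \<open>hardy_partial_identity\<close> requires, even for N = 0; \<open>u\<close> vanishes there,
    which removes the boundary term.\<close>
  let ?N = "Suc N"
  have "(\<Sum>\<^sub>\<infinity>n\<in>{1..}. hardy_weight n * (cmod (u n))\<^sup>2) = (\<Sum>n=1..?N. hardy_weight n * (cmod (u n))\<^sup>2)"
    "(\<Sum>\<^sub>\<infinity>n\<in>{2..}. hardy_remainder u n) = (\<Sum>n=2..?N. hardy_remainder u n)"
    "(\<Sum>\<^sub>\<infinity>n\<in>{1..}. (cmod (u n - u (n - 1)))\<^sup>2) = (\<Sum>n=1..?N. (cmod (u n - u (n - 1)))\<^sup>2)"
    by (rule infsum_eq_sum_atLeastAtMost; simp add: assms(2) hardy_remainder_def)+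
  then show ?thesis
    using hardy_partial_identity[of u ?N] assms by simp
qed

section \<open>The inequality for arbitrary sequences\<close>

lemma hardy_remainder_nonneg: "hardy_remainder u n \<ge> 0"
  by (simp add: hardy_remainder_def)

lemma sum_le_difference_sum:
  "ennreal (\<Sum>n=1..N. (cmod (u n - u (n - 1)))\<^sup>2) \<le> difference_sum u"
proof -
  have "(\<Sum>n=1..N. ennreal ((cmod (u n - u (n - 1)))\<^sup>2)) \<le> difference_sum u"
    unfolding difference_sum_def
    by (subst infsum_finite[symmetric], simp, rule infsum_mono_neutral)
       (auto intro: nonneg_summable_on_complete)
  then show ?thesis by (simp add: sum_ennreal)
qed

lemma hardy_partial_inequality:
  assumes "u 0 = 0"
  shows "(\<Sum>n=1..N. hardy_weight n * (cmod (u n))\<^sup>2) \<le> (\<Sum>n=1..N. (cmod (u n - u (n - 1)))\<^sup>2)"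
proof (cases "N = 0")
  case False
  then have "(sqrt ((real N + 1) / real N) - 1) * (cmod (u N))\<^sup>2 \<ge> 0"
    by (intro mult_nonneg_nonneg) simp_all
  moreover have "(\<Sum>n=2..N. hardy_remainder u n) \<ge> 0"
    by (intro sum_nonneg hardy_remainder_nonneg)
  moreover have "N \<ge> 1" using False by simp
  ultimately show ?thesis
    using hardy_partial_identity[of u N, OF assms] by linarith
qed simp

lemma hardy_inequality:
  assumes "u 0 = 0"
  shows "weighted_sum hardy_weight u \<le> difference_sum u"
  unfolding weighted_sum_def
proof (rule infsum_le_finite_sums)
  fix F :: "nat set" assume F: "finite F" "F \<subseteq> {1..}"
  let ?f = "\<lambda>n. hardy_weight n * (cmod (u n))\<^sup>2"
  have nonneg: "?f n \<ge> 0" if "n \<ge> 1" for n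
    using hardy_weight_pos[OF that] by simp
  \<comment> \<open>An arbitrary finite index set is enlarged to an initial segment, where the real
    partial inequality applies.\<close>
  have "(\<Sum>n\<in>F. ennreal (?f n)) \<le> (\<Sum>n=1..Max F. ennreal (?f n))"
    using F by (intro sum_mono2) auto
  also have "\<dots> = ennreal (\<Sum>n=1..Max F. ?f n)"
    using nonneg by (intro sum_ennreal) auto
  also have "\<dots> \<le> ennreal (\<Sum>n=1..Max F. (cmod (u n - u (n - 1)))\<^sup>2)"
    using hardy_partial_inequality[of u] assms by (intro ennreal_leI)
  also have "\<dots> \<le> difference_sum u"
    by (rule sum_le_difference_sum)
  finally show "(\<Sum>n\<in>F. ennreal (?f n)) \<le> difference_sum u" .
qed (simp add: nonneg_summable_on_complete)

section \<open>Optimality of the weight\<close>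

text \<open>After the substitution both coefficients in the remainder become the fourth root of n(n
  - 1), so only the increments of \<open>x\<close> survive; constant \<open>x\<close> gives
  remainder 0.\<close>

lemma hardy_remainder_sqrt_mult:
  assumes "n \<ge> 2"
  shows "hardy_remainder (\<lambda>n. of_real (sqrt (real n) * x n)) n
    = sqrt (real n * (real n - 1)) * (x n - x (n - 1))\<^sup>2"
proof -
  define p q where "p = sqrt (real n)" and "q = sqrt (real n - 1)"
  have pq: "p > 0" "q > 0" "p\<^sup>2 = real n" "q\<^sup>2 = real n - 1" "real (n - 1) = real n - 1"
    using assms by (auto simp: p_def q_def)
  have "hardy_remainder (\<lambda>n. of_real (sqrt (real n) * x n)) n =
     (p * x n - q * x (n - 1))\<^sup>2 - (1 - q / p) * (p * x n)\<^sup>2 - (1 - p / q) * (q * x (n - 1))\<^sup>2"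
    using assms pq(5)
    by (simp add: hardy_remainder_expand p_def q_def real_sqrt_divide norm_mult power_mult_distrib
        flip: of_real_mult of_real_diff)
  also have "\<dots> = p * q * (x n - x (n - 1))\<^sup>2"
    using pq(1,2) by (simp add: power2_eq_square field_simps)
  finally show ?thesis
    by (simp add: p_def q_def real_sqrt_mult)
qed

text \<open>The factor must tend to 1 pointwise while its squared increments, weighted by about n,
  have small sum. Decrements proportional to 1/n achieve this, hence the harmonic numbers.\<close>

definition log_cutoff :: "nat \<Rightarrow> nat \<Rightarrow> complex" where
  "log_cutoff N n = of_real (sqrt (real n) * (if n \<le> N then 1 - harm n / harm N else 0))"

lemma hardy_remainder_log_cutoff_le:
  assumes "2 \<le> n" "n \<le> N"
  shows "hardy_remainder (log_cutoff N) n \<le> (1 / real n) / (harm N)\<^sup>2"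
proof -
  have N: "harm N > (0::real)" using assms by (intro harm_pos) simp
  obtain k where k: "n = Suc k" using assms by (cases n) auto
  have "(1 - harm n / harm N) - (1 - harm (n - 1) / harm N) = - (1 / real n) / (harm N :: real)"
    using N by (simp add: k harm_Suc add_divide_distrib inverse_eq_divide)
  then have eq: "((1 - harm n / harm N) - (1 - harm (n - 1) / harm N))\<^sup>2 = ((1 / real n) / harm N :: real)\<^sup>2"
    by simp
  \<comment> \<open>With both n and n - 1 at most N, the two conditionals in
    \<open>log_cutoff\<close> take the same branch.\<close>
  have "n - 1 \<le> N" using assms by simp
  then have "hardy_remainder (log_cutoff N) n
      = sqrt (real n * (real n - 1)) * ((1 / real n) / harm N)\<^sup>2"
    unfolding log_cutoff_def[abs_def] hardy_remainder_sqrt_mult[OF assms(1)]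
    using assms(2) by (simp only: if_True eq)
  also have "\<dots> \<le> real n * ((1 / real n) / harm N)\<^sup>2"
  proof (rule mult_right_mono)
    show "sqrt (real n * (real n - 1)) \<le> real n"
      using assms by (intro real_le_lsqrt) (auto simp: power2_eq_square algebra_simps)
  qed simp
  also have "\<dots> = (1 / real n) / (harm N)\<^sup>2"
    using assms by (simp add: power2_eq_square)
  finally show ?thesis .
qed

lemma sum_hardy_remainder_log_cutoff_le:
  assumes "N \<ge> 1"
  shows "(\<Sum>n=2..N. hardy_remainder (log_cutoff N) n) \<le> 1 / harm N"
proof -
  have N: "harm N > (0::real)" using assms by (intro harm_pos) simp
  have "(\<Sum>n=2..N. hardy_remainder (log_cutoff N) n) \<le> (\<Sum>n=2..N. (1 / real n) / (harm N)\<^sup>2)"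
    by (intro sum_mono hardy_remainder_log_cutoff_le) auto
  \<comment> \<open>Adding the nonnegative term n = 1 completes the harmonic sum.\<close>
  also have "\<dots> \<le> (\<Sum>n=1..N. (1 / real n) / (harm N)\<^sup>2)"
    by (intro sum_mono2) auto
  also have "\<dots> = harm N / (harm N)\<^sup>2"
    by (simp add: harm_def inverse_eq_divide sum_divide_distrib)
  finally show ?thesis using N by (simp add: power2_eq_square)
qed

text \<open>Subtracting the partial identity from the assumed inequality for
  \<open>log_cutoff N\<close> bounds the total excess by the remainder sum. Every excess term is
  nonnegative, so the one at \<open>m\<close> obeys the same bound.\<close>

lemma weight_excess_le:
  assumes w': "\<And>n. n \<ge> 1 \<Longrightarrow> w' n \<ge> hardy_weight n"
    and ineq: "weighted_sum w' (log_cutoff N) \<le> difference_sum (log_cutoff N)"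
    and m: "1 \<le> m" "m \<le> N"
  shows "(w' m - hardy_weight m) * (real m * (1 - harm m / harm N)\<^sup>2) \<le> 1 / harm N"
proof -
  let ?u = "log_cutoff N"
  have N: "N \<ge> 1" "harm N > (0::real)" using m by (auto intro!: harm_pos)
  \<comment> \<open>The cutoff factor is already 0 at n = N itself, so the boundary term at N drops
    out.\<close>
  have zero: "?u n = 0" if "n \<ge> N" for n
    using that less_imp_neq[OF N(2)] by (cases "n = N") (auto simp: log_cutoff_def)
  have nonneg: "w' n * (cmod (?u n))\<^sup>2 \<ge> 0" if "n \<ge> 1" for n
    using hardy_weight_pos[OF that] w'[OF that] by simp
  have "weighted_sum w' ?u = ennreal (\<Sum>n=1..N. w' n * (cmod (?u n))\<^sup>2)"
    unfolding weighted_sum_def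
    by (subst infsum_eq_sum_atLeastAtMost[of N]) (auto simp: zero nonneg intro!: sum_ennreal)
  moreover have "difference_sum ?u = ennreal (\<Sum>n=1..N. (cmod (?u n - ?u (n - 1)))\<^sup>2)"
    unfolding difference_sum_def
    by (subst infsum_eq_sum_atLeastAtMost[of N]) (auto simp: zero)
  ultimately have "(\<Sum>n=1..N. w' n * (cmod (?u n))\<^sup>2) \<le> (\<Sum>n=1..N. (cmod (?u n - ?u (n - 1)))\<^sup>2)"
    using ineq by (simp add: sum_nonneg)
  also have "\<dots> = (\<Sum>n=1..N. hardy_weight n * (cmod (?u n))\<^sup>2) + (\<Sum>n=2..N. hardy_remainder ?u n)"
    using hardy_partial_identity[of ?u N] N zero[of N] by (simp add: log_cutoff_def)
  also have "(\<Sum>n=2..N. hardy_remainder ?u n) \<le> 1 / harm N"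
    by (rule sum_hardy_remainder_log_cutoff_le[OF N(1)])
  finally have "(\<Sum>n=1..N. (w' n - hardy_weight n) * (cmod (?u n))\<^sup>2) \<le> 1 / harm N"
    by (simp add: left_diff_distrib sum_subtractf)
  moreover have "(w' m - hardy_weight m) * (cmod (?u m))\<^sup>2
      \<le> (\<Sum>n=1..N. (w' n - hardy_weight n) * (cmod (?u n))\<^sup>2)"
    using m w' by (intro member_le_sum) auto
  moreover have "(cmod (?u m))\<^sup>2 = real m * (1 - harm m / harm N)\<^sup>2"
    unfolding log_cutoff_def using m by (simp only: norm_of_real) (simp add: power_mult_distrib)
  ultimately show ?thesis by simp
qed

lemma hardy_weight_optimal:
  assumes w': "\<And>n. n \<ge> 1 \<Longrightarrow> w' n \<ge> hardy_weight n"
    and ineq: "\<And>u. u 0 = 0 \<Longrightarrow> weighted_sum w' u \<le> difference_sum u"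
    and m: "m \<ge> 1"
  shows "w' m = hardy_weight m"
proof -
  have h: "filterlim (harm :: nat \<Rightarrow> real) at_top sequentially"
    by (rule harm_at_top)
  have lim: "(\<lambda>N. c / harm N :: real) \<longlonglongrightarrow> 0" for c
    by (rule tendsto_divide_0[OF tendsto_const filterlim_at_top_imp_at_infinity[OF h]])
  \<comment> \<open>With \<open>m\<close> fixed and N growing, \<open>harm m / harm N\<close> and
    the bound \<open>1 / harm N\<close> both tend to 0.\<close>
  have "(\<lambda>N. (w' m - hardy_weight m) * (real m * (1 - harm m / harm N)\<^sup>2))
      \<longlonglongrightarrow> (w' m - hardy_weight m) * (real m * (1 - 0)\<^sup>2)"
    by (intro tendsto_intros lim)
  moreover have "\<forall>\<^sub>F N in sequentially.
      (w' m - hardy_weight m) * (real m * (1 - harm m / harm N)\<^sup>2) \<le> 1 / harm N"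
    using eventually_ge_at_top[of m]
    by eventually_elim (rule weight_excess_le[OF w' ineq m], auto simp: log_cutoff_def)
  ultimately have "(w' m - hardy_weight m) * (real m * (1 - 0)\<^sup>2) \<le> 0"
    using lim[of 1] by (intro tendsto_le[OF sequentially_bot]) 
  then have "w' m \<le> hardy_weight m"
    using m by (simp add: mult_le_0_iff)
  then show ?thesis using w'[OF m] by simp
qed

theorem theorem1:
  shows "(\<forall>u :: nat \<Rightarrow> complex. finite {n. u n \<noteq> 0} \<and> u 0 = 0 \<longrightarrow>
            (\<Sum>\<^sub>\<infinity>n\<in>{1..}. hardy_weight n * (cmod (u n))\<^sup>2)
            + (\<Sum>\<^sub>\<infinity>n\<in>{2..}. (cmod (of_real (root 4 ((real n - 1) / real n)) * u n
                              - of_real (root 4 (real n / (real n - 1))) * u (n - 1)))\<^sup>2)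
            = (\<Sum>\<^sub>\<infinity>n\<in>{1..}. (cmod (u n - u (n - 1)))\<^sup>2))
       \<and> (\<forall>u :: nat \<Rightarrow> complex. u 0 = 0 \<longrightarrow> weighted_sum hardy_weight u \<le> difference_sum u)
       \<and> (\<forall>w' :: nat \<Rightarrow> real.
            (\<forall>n\<ge>1. w' n \<ge> hardy_weight n)
            \<and> (\<forall>u :: nat \<Rightarrow> complex. u 0 = 0 \<longrightarrow> weighted_sum w' u \<le> difference_sum u)
            \<longrightarrow> (\<forall>n\<ge>1. w' n = hardy_weight n))"
proof (intro conjI allI impI; (elim conjE)?)
  fix u :: "nat \<Rightarrow> complex"
  assume fin: "finite {n. u n \<noteq> 0}" and u0: "u 0 = 0"
  obtain N where "\<And>n. u n \<noteq> 0 \<Longrightarrow> n < N"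
    using finite_nat_bounded[OF fin] by auto
  then have "\<And>n. n \<ge> N \<Longrightarrow> u n = 0"
    by (meson not_le)
  then show "(\<Sum>\<^sub>\<infinity>n\<in>{1..}. hardy_weight n * (cmod (u n))\<^sup>2)
      + (\<Sum>\<^sub>\<infinity>n\<in>{2..}. (cmod (of_real (root 4 ((real n - 1) / real n)) * u n
           - of_real (root 4 (real n / (real n - 1))) * u (n - 1)))\<^sup>2)
      = (\<Sum>\<^sub>\<infinity>n\<in>{1..}. (cmod (u n - u (n - 1)))\<^sup>2)"
    using hardy_identity[of u N] u0 unfolding hardy_remainder_def by simp
qed (auto intro: hardy_inequality hardy_weight_optimal)

end
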